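(* Let $c>0$, let $\|a+bi\|=\sqrt{a^2+b^2}$ for $a,b\in\mathbb{R}$, and let $\mathbb{C}_c=\{z\in\mathbb{C} : \|z\|<c\}$. Define binary operations on $\mathbb{C}_c$ by $$u\oplus_{\mathbb{C}_c}v=c\tanh\bigl(\|A(u,v)\|\bigr)\frac{A(u,v)}{\|A(u,v)\|},\qquad A(u,v)=\operatorname{atanh}\!\left(\frac{\|u\|}{c}\right)\frac{u}{\|u\|}+\operatorname{atanh}\!\left(\frac{\|v\|}{c}\right)\frac{v}{\|v\|},$$ $$u\odot_{\mathbb{C}_c}v=c\tanh\bigl(\|M(u,v)\|\bigr)\frac{M(u,v)}{\|M(u,v)\|},\qquad M(u,v)=\operatorname{atanh}\!\left(\frac{\|u\|}{c}\right)\frac{u}{\|u\|}\cdot\operatorname{atanh}\!\left(\frac{\|v\|}{c}\right)\frac{v}{\|v\|}.$$ Then $(\mathbb{C}_c\setminus\{0\},\odot_{\mathbb{C}_c})$ is a commutative group, the distributive laws hold between $\odot_{\mathbb{C}_c}$ and $\oplus_{\mathbb{C}_c}$, and $(\mathbb{C}_c,\oplus_{\mathbb{C}_c},\odot_{\mathbb{C}_c})$ is a field isomorphic to the field of complex numbers $\mathbb{C}$.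
   Context: Conventions at zero: the expression $\operatorname{atanh}(\|u\|/c)\,u/\|u\|$ is understood to be $0$ when $u=0$, and $c\tanh(\|w\|)\,w/\|w\|$ is understood to be $0$ when $w=0$. Here $\operatorname{atanh}:(-1,1)\to\mathbb{R}$ is the inverse of $\tanh$, and $\cdot$ is the usual multiplication of complex numbers. *)

theory Defs
  imports Complex_Main "HOL-Algebra.QuotRing" "HOL-Algebra.Algebraic_Closure_Type"
begin

definition cdisc :: "real \<Rightarrow> complex set" where
  "cdisc c = {z. cmod z < c}"

(* The conventions at zero hold because x / 0 = 0 in HOL:
   both maps below send 0 to 0. *)

definition atanh_vec :: "real \<Rightarrow> complex \<Rightarrow> complex" where
  "atanh_vec c u = complex_of_real (artanh (cmod u / c)) * (u / complex_of_real (cmod u))"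

definition tanh_vec :: "real \<Rightarrow> complex \<Rightarrow> complex" where
  "tanh_vec c w = complex_of_real (c * tanh (cmod w)) * (w / complex_of_real (cmod w))"

definition cdisc_add :: "real \<Rightarrow> complex \<Rightarrow> complex \<Rightarrow> complex" where
  "cdisc_add c u v = tanh_vec c (atanh_vec c u + atanh_vec c v)"

definition cdisc_mult :: "real \<Rightarrow> complex \<Rightarrow> complex \<Rightarrow> complex" where
  "cdisc_mult c u v = tanh_vec c (atanh_vec c u * atanh_vec c v)"

(* HOL-Algebra records carry the identity elements explicitly. They are determined
   by the operations: 0 for the addition, and for the multiplication the element
   c tanh 1, whose image under atanh_vec c is 1. *)

definition cdisc_units :: "real \<Rightarrow> complex monoid" where
  "cdisc_units c = \<lparr>carrier = cdisc c - {0}, monoid.mult = cdisc_mult c,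
     one = complex_of_real (c * tanh 1)\<rparr>"

definition cdisc_ring :: "real \<Rightarrow> complex ring" where
  "cdisc_ring c = \<lparr>carrier = cdisc c, monoid.mult = cdisc_mult c,
     one = complex_of_real (c * tanh 1), ring.zero = 0, add = cdisc_add c\<rparr>"

end

(* The map tanh_vec c is a bijection from the complex numbers onto the disc with inverse
   atanh_vec c, and both operations on the disc are the usual ones transported along it. *)

theory Submission
  imports Defs
begin

text \<open>Since tanh maps [0, \<infinity>) bijectively onto [0, 1), rescaling lengths by r
  \<mapsto> c tanh r and keeping directions carries the plane onto the disc; this is
  \<open>tanh_vec c\<close>, with inverse \<open>atanh_vec c\<close>. In a nested operation each
  inner \<open>tanh_vec c\<close> meets an \<open>atanh_vec c\<close> and cancels, so
  \<open>tanh_vec c\<close> is a ring isomorphism (\<open>tanh_vec_ring_iso\<close>). The field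
  axioms pass to the disc along it, and the multiplicative group is the group of units of that
  field.\<close>

lemma tanh_artanh_real:
  fixes x :: real
  assumes "\<bar>x\<bar> < 1"
  shows "tanh (artanh x) = x"
proof -
  have pos: "1 + x > 0" "1 - x > 0"
    using assms by auto
  have "exp (- 2 * artanh x) = inverse (exp (ln ((1 + x) / (1 - x))))"
    by (simp add: artanh_def exp_minus)
  also have "\<dots> = (1 - x) / (1 + x)"
    using pos by simp
  finally have "tanh (artanh x) = (1 - (1 - x) / (1 + x)) / (1 + (1 - x) / (1 + x))"
    by (simp only: tanh_real_altdef)
  also have "\<dots> = x"
    using pos by (simp add: field_simps)
  finally show ?thesis .
qed

lemma tanh_vec_in_cdisc:
  assumes "c > 0"
  shows "tanh_vec c w \<in> cdisc c"
  using assms tanh_real_lt_1[of "cmod w"]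
  by (cases "w = 0") (auto simp: tanh_vec_def cdisc_def norm_mult norm_divide)

lemma atanh_vec_tanh_vec:
  assumes "c > 0"
  shows "atanh_vec c (tanh_vec c w) = w"
proof (cases "w = 0")
  case True
  then show ?thesis by (simp add: atanh_vec_def tanh_vec_def)
next
  case False
  have norm: "cmod (tanh_vec c w) = c * tanh (cmod w)"
    using assms False by (simp add: tanh_vec_def norm_mult norm_divide)
  have "tanh_vec c w / complex_of_real (c * tanh (cmod w)) = w / complex_of_real (cmod w)"
    using assms False by (simp add: tanh_vec_def)
  then show ?thesis
    using assms False by (simp add: atanh_vec_def norm artanh_tanh_real)
qed

lemma tanh_vec_atanh_vec:
  assumes "c > 0" and "u \<in> cdisc c"
  shows "tanh_vec c (atanh_vec c u) = u"
proof (cases "u = 0")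
  case True
  then show ?thesis by (simp add: atanh_vec_def tanh_vec_def)
next
  case False
  have tanh: "tanh (artanh (cmod u / c)) = cmod u / c"
    using assms by (intro tanh_artanh_real) (simp add: cdisc_def)
  \<comment> \<open>Positivity makes this number the norm of \<open>atanh_vec c u\<close> itself,
    and keeps the direction of \<open>u\<close>.\<close>
  have pos: "artanh (cmod u / c) > 0"
    using assms(1) False tanh_real_pos_iff[of "artanh (cmod u / c)"] by (simp add: tanh)
  have norm: "cmod (atanh_vec c u) = artanh (cmod u / c)"
    using pos False by (simp add: atanh_vec_def norm_mult norm_divide)
  have "atanh_vec c u / complex_of_real (artanh (cmod u / c)) = u / complex_of_real (cmod u)"
    using pos by (simp add: atanh_vec_def)
  then show ?thesis
    using assms(1) False by (simp add: tanh_vec_def norm tanh)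
qed

lemma tanh_vec_0: "tanh_vec c 0 = 0"
  by (simp add: tanh_vec_def)

lemma tanh_vec_1: "tanh_vec c 1 = complex_of_real (c * tanh 1)"
  by (simp add: tanh_vec_def)

lemma bij_betw_tanh_vec:
  assumes "c > 0"
  shows "bij_betw (tanh_vec c) UNIV (cdisc c)"
  by (rule bij_betw_byWitness[where f' = "atanh_vec c"])
     (auto simp: assms atanh_vec_tanh_vec tanh_vec_atanh_vec tanh_vec_in_cdisc)

text \<open>Both homomorphism laws are the cancellation of \<open>atanh_vec c\<close> against
  \<open>tanh_vec c\<close> in the definitions of the operations.\<close>

lemma tanh_vec_ring_iso:
  assumes "c > 0"
  shows "tanh_vec c \<in> ring_iso (ring_of_type_algebra :: complex ring) (cdisc_ring c)"
  by (rule ring_iso_memI)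
     (simp_all add: assms ring_of_type_algebra_def cdisc_ring_def cdisc_mult_def cdisc_add_def
       tanh_vec_in_cdisc atanh_vec_tanh_vec bij_betw_tanh_vec tanh_vec_1)

lemma field_cdisc_ring:
  assumes "c > 0"
  shows "field (cdisc_ring c)"
proof -
  interpret C: field "ring_of_type_algebra :: complex ring"
    by (rule field_from_type_algebra)
  \<comment> \<open>The transfer of the field axioms yields a record whose zero is the image of
    zero; that image is already the zero of \<open>cdisc_ring c\<close>.\<close>
  have "cdisc_ring c\<lparr>zero := tanh_vec c \<zero>\<^bsub>(ring_of_type_algebra :: complex ring)\<^esub>\<rparr> = cdisc_ring c"
    by (simp add: cdisc_ring_def ring_of_type_algebra_def tanh_vec_0)
  then show ?thesis
    using C.ring_iso_imp_img_field[OF tanh_vec_ring_iso[OF assms]] by simp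
qed

text \<open>In a field the units are exactly the nonzero elements.\<close>

lemma units_of_cdisc_ring:
  assumes "c > 0"
  shows "units_of (cdisc_ring c) = cdisc_units c"
  using field.field_Units[OF field_cdisc_ring[OF assms]]
  by (simp add: units_of_def cdisc_units_def cdisc_ring_def)

theorem mainTheorem2:
  fixes c :: real
  assumes "c > 0"
  shows "comm_group (cdisc_units c)
    \<and> (\<forall>u \<in> cdisc c. \<forall>v \<in> cdisc c. \<forall>w \<in> cdisc c.
          cdisc_mult c u (cdisc_add c v w) = cdisc_add c (cdisc_mult c u v) (cdisc_mult c u w)
        \<and> cdisc_mult c (cdisc_add c u v) w = cdisc_add c (cdisc_mult c u w) (cdisc_mult c v w))
    \<and> field (cdisc_ring c)
    \<and> cdisc_ring c \<simeq> (ring_of_type_algebra :: complex ring)"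
proof -
  interpret D: field "cdisc_ring c"
    using assms by (rule field_cdisc_ring)
  have "comm_group (cdisc_units c)"
    using D.units_comm_group by (simp add: units_of_cdisc_ring assms)
  \<comment> \<open>After cancellation both sides are \<open>tanh_vec c\<close> of the two sides of
    a distributive law in the complex numbers.\<close>
  moreover have "cdisc_mult c u (cdisc_add c v w) = cdisc_add c (cdisc_mult c u v) (cdisc_mult c u w)"
    and "cdisc_mult c (cdisc_add c u v) w = cdisc_add c (cdisc_mult c u w) (cdisc_mult c v w)"
    for u v w
    by (simp_all add: cdisc_mult_def cdisc_add_def atanh_vec_tanh_vec assms algebra_simps)
  moreover have "cdisc_ring c \<simeq> (ring_of_type_algebra :: complex ring)"
    \<comment> \<open>\<open>tanh_vec c\<close> goes from the complex numbers to the disc, so the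
      relation is reversed.\<close>
    using tanh_vec_ring_iso[OF assms] ring_iso_sym[OF ring_from_type_algebra]
    unfolding is_ring_iso_def by blast
  ultimately show ?thesis
    using D.field_axioms by blast
qed

end
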